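(* Let $\Omega_0=\{(E_c\cdot x)_{c\in\mathcal I}\in\mathcal H: x\in\mathbb C^{n\times n}\}$ and $A=\{(x,x,\dots,x)\in\mathcal H^m: x\in\Omega_0\}$. For any $w=(w_1,w_2,\ldots,w_m)\in\mathcal H^m$, the projection of $w$ on $A$ is unique and given by $$P_A(w)=\big[(E_c\cdot\overline z)_{c\in\mathcal I}\big]_m\quad\text{with}\quad\overline z=\frac12\sum_{c\in\mathcal I}(E_c\cdot\overline w_c),$$ where $\overline w=(\overline w_c)_{c\in\mathcal I}=\frac1m\sum_{d=1}^m w_d$.
   Context: Let $n,m\ge1$ be integers. Products and equalities of $n\times n$ arrays are elementwise; indices are $\xi=(\xi_1,\xi_2)$, $1\le\xi_1,\xi_2\le n$, and $w[\xi]$ is the entry of $w$ at $\xi$. Let $\mathcal I=\{XX,XY,XZ,YX,YY,YZ\}$ and $\mathcal H=(\mathbb C^{n\times n})^6$, with elements $x=(x_c)_{c\in\mathcal I}$, with Frobenius norm $\|x\|^2=\sum_{c\in\mathcal I}\sum_\xi|x_c[\xi]|^2$; $\mathcal H^m$ carries the norm $\|(w_1,\dots,w_m)\|^2=\sum_d\|w_d\|^2$. For $x\in\mathcal H$, $[x]_m=(x,x,\dots,x)\in\mathcal H^m$ ($m$ times). For a set $\Omega$, $P_\Omega(x)=\{w\in\Omega:\|x-w\|=\inf_{v\in\Omega}\|x-v\|\}$; when it is a singleton $\{w\}$ one writes $P_\Omega(x)=w$. The matrices $E_c$: for every index $\xi$ (sampling point of the lens aperture) let $(k_X,k_Y,k_Z)=(k_X[\xi],k_Y[\xi],k_Z[\xi])\in\mathbb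 R^3$ be a unit vector (the unit wave vector) with $1+k_Z\neq0$. The real $n\times n$ matrices $E_c$ are given entrywise by $E_{XX}=1-\frac{k_X^2}{1+k_Z}$, $E_{XY}=E_{YX}=-\frac{k_Xk_Y}{1+k_Z}$, $E_{YY}=1-\frac{k_Y^2}{1+k_Z}$, $E_{XZ}=-k_X$, $E_{YZ}=-k_Y$; they satisfy $\sum_{c\in\mathcal I}E_c^2=2$ in every entry. *)

theory Defs
  imports "HOL-Analysis.Analysis"
begin

datatype comp = XX | XY | XZ | YX | YY | YZ

lemma UNIV_comp: "UNIV = {XX, XY, XZ, YX, YY, YZ}"
proof -
  have "c \<in> {XX, XY, XZ, YX, YY, YZ}" for c :: comp
    by (cases c) simp_all
  then show ?thesis by blast
qed

instance comp :: finite
  by standard (simp add: UNIV_comp)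

text \<open>
  An \<open>n \<times> n\<close> array is a value of type \<open>complex^'n^'n\<close> with \<open>n = CARD('n)\<close>, and \<open>\<H>\<^sup>m\<close> is
  \<open>'n fields^'m\<close> with \<open>m = CARD('m)\<close>. The norm of the library type \<^type>\<open>vec\<close> is the
  \<open>\<ell>\<^sup>2\<close> norm of the norms of the components, so on these nested types \<^const>\<open>norm\<close> is the
  Frobenius norm.
\<close>

type_synonym 'n fields = "complex^'n^'n^comp"

definition hadamard :: "real^'n^'n \<Rightarrow> complex^'n^'n \<Rightarrow> complex^'n^'n"  (infixl "\<odot>" 70)
  where "a \<odot> x = (\<chi> i j. complex_of_real (a $ i $ j) * x $ i $ j)"

text \<open>
  \<open>k $ i $ j\<close> is the wave vector at the index \<open>\<xi> = (i, j)\<close>; its entries 1, 2, 3 are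
  \<open>k\<^sub>X\<close>, \<open>k\<^sub>Y\<close>, \<open>k\<^sub>Z\<close>.
\<close>

primrec E :: "real^3^'n^'n \<Rightarrow> comp \<Rightarrow> real^'n^'n" where
  "E k XX = (\<chi> i j. 1 - (k $ i $ j $ 1)\<^sup>2 / (1 + k $ i $ j $ 3))"
| "E k XY = (\<chi> i j. - (k $ i $ j $ 1 * k $ i $ j $ 2 / (1 + k $ i $ j $ 3)))"
| "E k XZ = (\<chi> i j. - k $ i $ j $ 1)"
| "E k YX = (\<chi> i j. - (k $ i $ j $ 1 * k $ i $ j $ 2 / (1 + k $ i $ j $ 3)))"
| "E k YY = (\<chi> i j. 1 - (k $ i $ j $ 2)\<^sup>2 / (1 + k $ i $ j $ 3))"
| "E k YZ = (\<chi> i j. - k $ i $ j $ 2)"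

definition fields_of :: "real^3^'n^'n \<Rightarrow> complex^'n^'n \<Rightarrow> 'n fields"
  where "fields_of k x = (\<chi> c. E k c \<odot> x)"

definition diag :: "'a \<Rightarrow> 'a^'m"
  where "diag x = (\<chi> d. x)"

definition \<Omega>\<^sub>0 :: "real^3^'n^'n \<Rightarrow> 'n fields set"
  where "\<Omega>\<^sub>0 k = {fields_of k x | x. True}"

definition diag_set :: "real^3^'n^'n \<Rightarrow> ('n fields^'m) set"
  where "diag_set k = {diag x | x. x \<in> \<Omega>\<^sub>0 k}"

text \<open>The set of all nearest points, which may be empty or have several elements.\<close>

definition proj :: "'a::real_normed_vector set \<Rightarrow> 'a \<Rightarrow> 'a set"
  where "proj S x = {w \<in> S. norm (x - w) = (INF v\<in>S. norm (x - v))}"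

end

theory Submission
  imports Defs
begin

text \<open>
  The set in question is the range of the linear map \<open>T\<close> that sends an array \<open>x\<close> to \<open>m\<close> copies of
  \<open>(E\<^sub>c \<odot> x)\<^sub>c\<close>. Elementwise multiplication by a real array is self-adjoint and
  \<open>\<Sum>\<^sub>c E\<^sub>c\<^sup>2 = 2\<close> in every entry, so \<open>T x \<bullet> T y = 2 m (x \<bullet> y)\<close>: up to the factor
  \<open>2 m\<close>, the map \<open>T\<close> is an isometry. The nearest point to \<open>w\<close> in the range of such a map is
  \<open>T ((1 / (2 m)) T\<^sup>* w)\<close>, because \<open>T\<^sup>* T = 2 m\<close> turns the normal equation
  \<open>T\<^sup>* (w - T z) = 0\<close> into \<open>T\<^sup>* w = 2 m z\<close>. Here \<open>T\<^sup>*\<close> multiplies each component of each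
  copy by its \<open>E\<^sub>c\<close> and adds up everything; dividing the sum over the copies by \<open>m\<close> gives the mean
  of the \<open>w\<^sub>d\<close>, and the remaining factor is \<open>1 / 2\<close>.
\<close>

text \<open>
  The error \<open>w - T z\<close> is orthogonal to the range, so by Pythagoras the squared distance from \<open>w\<close> to
  \<open>T y\<close> exceeds that to \<open>T z\<close> by \<open>a \<parallel>z - y\<parallel>\<^sup>2\<close>. The infimum is therefore attained at \<open>T z\<close> and
  nowhere else. The vector \<open>r\<close> is \<open>T\<^sup>* w\<close>, and \<open>z = r / a\<close>.
\<close>

lemma proj_range_scaled_isometry:
  fixes T :: "'a::real_inner \<Rightarrow> 'b::real_inner"
  assumes "linear T" and "a > 0"
    and isometry: "\<And>x y. T x \<bullet> T y = a * (x \<bullet> y)"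
    and adjoint: "\<And>x. T x \<bullet> w = x \<bullet> r"
  shows "proj (range T) w = {T ((1 / a) *\<^sub>R r)}"
proof -
  define z where "z = (1 / a) *\<^sub>R r"
  have pythagoras: "(norm (w - T y))\<^sup>2 = (norm (w - T z))\<^sup>2 + a * (norm (z - y))\<^sup>2" for y
  proof -
    have "T (z - y) \<bullet> (w - T z) = 0"
      using \<open>a > 0\<close> by (simp add: inner_diff_right adjoint isometry z_def)
    moreover have "w - T y = (w - T z) + T (z - y)"
      by (simp add: linear_diff[OF \<open>linear T\<close>])
    ultimately show ?thesis
      by (simp only: power2_norm_eq_inner inner_add_left inner_add_right inner_commute
          flip: isometry)
  qed
  have le: "norm (w - T z) \<le> norm (w - T y)" for y
    by (rule power2_le_imp_le) (use pythagoras[of y] \<open>a > 0\<close> in auto)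
  have "(INF v\<in>range T. norm (w - v)) = norm (w - T z)"
    by (rule cInf_eq_minimum) (use le in auto)
  moreover have "y = z" if "norm (w - T y) = norm (w - T z)" for y
    using pythagoras[of y] that \<open>a > 0\<close> by simp
  ultimately show ?thesis
    by (auto simp: proj_def simp flip: z_def)
qed

lemma hadamard_nth: "(a \<odot> x) $ i $ j = a $ i $ j *\<^sub>R x $ i $ j"
  by (simp add: hadamard_def scaleR_conv_of_real)

lemma linear_hadamard: "linear (\<lambda>x. a \<odot> x)"
  by (rule linearI) (simp_all add: vec_eq_iff hadamard_nth algebra_simps)

lemma inner_hadamard_commute: "(a \<odot> x) \<bullet> y = x \<bullet> (a \<odot> y)"
  by (simp add: inner_vec_def hadamard_nth)

text \<open>
  Writing \<open>s = 1 + k\<^sub>Z\<close>, the unit length of the wave vector says \<open>k\<^sub>X\<^sup>2 + k\<^sub>Y\<^sup>2 = s (2 - s)\<close>, and the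
  sum depends on \<open>k\<^sub>X\<close> and \<open>k\<^sub>Y\<close> only through this quantity.
\<close>

lemma sum_E_squared:
  assumes "norm (k $ i $ j) = 1" and "1 + k $ i $ j $ 3 \<noteq> 0"
  shows "(\<Sum>c\<in>UNIV. (E k c $ i $ j)\<^sup>2) = 2"
proof -
  define x y s where "x = k $ i $ j $ 1" and "y = k $ i $ j $ 2" and "s = 1 + k $ i $ j $ 3"
  have "x\<^sup>2 + y\<^sup>2 + (s - 1)\<^sup>2 = 1"
    using assms(1) by (simp add: norm_eq_1 inner_vec_def sum_3 x_def y_def s_def power2_eq_square)
  then have unit: "x\<^sup>2 + y\<^sup>2 = s * (2 - s)"
    by (simp add: power2_eq_square algebra_simps)
  have "s \<noteq> 0"
    using assms(2) by (simp add: s_def)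
  have "(\<Sum>c\<in>UNIV. (E k c $ i $ j)\<^sup>2)
      = (1 - x\<^sup>2 / s)\<^sup>2 + 2 * (x * y / s)\<^sup>2 + (1 - y\<^sup>2 / s)\<^sup>2 + x\<^sup>2 + y\<^sup>2"
    by (simp add: UNIV_comp x_def y_def s_def)
  also have "\<dots> = 2 - 2 * ((x\<^sup>2 + y\<^sup>2) / s) + ((x\<^sup>2 + y\<^sup>2) / s)\<^sup>2 + (x\<^sup>2 + y\<^sup>2)"
    using \<open>s \<noteq> 0\<close> by (simp add: field_simps power2_eq_square)
  also have "(x\<^sup>2 + y\<^sup>2) / s = 2 - s"
    using \<open>s \<noteq> 0\<close> by (simp add: unit)
  also have "2 - 2 * (2 - s) + (2 - s)\<^sup>2 + (x\<^sup>2 + y\<^sup>2) = 2"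
    unfolding unit by (simp add: power2_eq_square algebra_simps)
  finally show ?thesis .
qed

lemma inner_fields_of_left: "fields_of k x \<bullet> v = x \<bullet> (\<Sum>c\<in>UNIV. E k c \<odot> v $ c)"
  unfolding inner_vec_def[of "fields_of k x"]
  by (simp add: fields_of_def inner_hadamard_commute inner_sum_right)

lemma inner_fields_of:
  assumes "\<And>i j. norm (k $ i $ j) = 1" and "\<And>i j. 1 + k $ i $ j $ 3 \<noteq> 0"
  shows "fields_of k x \<bullet> fields_of k y = 2 * (x \<bullet> y)"
proof -
  have "(\<Sum>c\<in>UNIV. E k c \<odot> (E k c \<odot> y)) $ i $ j = (2 *\<^sub>R y) $ i $ j" for i j
    using sum_E_squared[of k i j, OF assms]
    by (simp add: hadamard_nth power2_eq_square flip: scaleR_sum_left)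
  then have "(\<Sum>c\<in>UNIV. E k c \<odot> (E k c \<odot> y)) = 2 *\<^sub>R y"
    by (simp add: vec_eq_iff)
  then show ?thesis
    by (simp add: inner_fields_of_left) (simp add: fields_of_def)
qed

lemma inner_diag_left: "diag x \<bullet> w = x \<bullet> (\<Sum>d\<in>UNIV. w $ d)"
  unfolding inner_vec_def[of "diag x"] by (simp add: diag_def inner_sum_right)

lemma linear_diag_fields_of: "linear (\<lambda>x. diag (fields_of k x))"
  by (rule linearI)
    (simp_all add: vec_eq_iff diag_def fields_of_def linear_add[OF linear_hadamard]
      linear_scale[OF linear_hadamard])

theorem lemma3p8:
  fixes k :: "real^3^'n^'n" and w :: "'n fields^'m"
  assumes "\<And>i j. norm (k $ i $ j) = 1"
    and "\<And>i j. 1 + k $ i $ j $ 3 \<noteq> 0"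
  shows "let wbar = (1 / real CARD('m)) *\<^sub>R (\<Sum>d\<in>UNIV. w $ d);
             zbar = (1 / 2) *\<^sub>R (\<Sum>c\<in>UNIV. E k c \<odot> wbar $ c)
         in proj (diag_set k) w = {diag (\<chi> c. E k c \<odot> zbar)}"
proof -
  let ?T = "\<lambda>x. diag (fields_of k x) :: 'n fields^'m"
  let ?m = "real CARD('m)"
  let ?r = "\<Sum>c\<in>UNIV. E k c \<odot> (\<Sum>d\<in>UNIV. w $ d) $ c"
  have "diag_set k = range ?T"
    by (auto simp: diag_set_def \<Omega>\<^sub>0_def)
  moreover have "proj (range ?T) w = {?T ((1 / (2 * ?m)) *\<^sub>R ?r)}"
  proof (rule proj_range_scaled_isometry[OF linear_diag_fields_of])
    show "?T x \<bullet> ?T y = 2 * ?m * (x \<bullet> y)" for x y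
      by (simp add: inner_diag_left inner_fields_of[OF assms] diag_def[of "fields_of k y"]
          sum_constant_scaleR del: sum_constant)
    show "?T x \<bullet> w = x \<bullet> ?r" for x
      by (simp only: inner_diag_left inner_fields_of_left)
  qed simp
  moreover have "(1 / (2 * ?m)) *\<^sub>R ?r
      = (1 / 2) *\<^sub>R (\<Sum>c\<in>UNIV. E k c \<odot> ((1 / ?m) *\<^sub>R (\<Sum>d\<in>UNIV. w $ d)) $ c)"
    by (simp add: linear_scale[OF linear_hadamard] flip: scaleR_sum_right
        del: sum_component)
  ultimately show ?thesis
    by (simp add: Let_def fields_of_def)
qed

end
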